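(* There exists a bidual renorming of $\ell_\infty$ which is almost square (ASQ).
   Context: A Banach space $X$ with unit sphere $S_X$ is almost square (ASQ) if for every $\varepsilon > 0$ and every finite set $(x_i)_{i=1}^n \subset S_X$ there exists $h \in S_X$ such that $\|x_i + h\| \le 1 + \varepsilon$ and $\|x_i - h\| \le 1+\varepsilon$ for every $i = 1, \dots, n$. A renorming of a Banach space is the same vector space endowed with an equivalent norm. A bidual renorming of $\ell_\infty = c_0^{**}$ is $\ell_\infty$ endowed with an equivalent norm which is the bidual norm of an equivalent norm on $c_0$. *)

theory Defs
  imports "HOL-Analysis.Analysis"
begin

section \<open>The real sequence spaces\<close>

text \<open>All Banach spaces are real. Every sequence is continuous on the discrete space \<^typ>\<open>nat\<close>, so
  bounded continuous functions on \<^typ>\<open>nat\<close> are exactly the bounded sequences, and the library norm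
  on them is the supremum norm.\<close>

type_synonym linfty = "nat \<Rightarrow>\<^sub>C real"

typedef c0 = "{x :: linfty. apply_bcontfun x \<longlonglongrightarrow> 0}"
  morphisms linfty_of_c0 Abs_c0
  by (rule exI[of _ 0]) simp

setup_lifting type_definition_c0

instantiation c0 :: real_vector
begin

lift_definition zero_c0 :: c0 is 0
  by simp

lift_definition plus_c0 :: "c0 \<Rightarrow> c0 \<Rightarrow> c0" is "(+)"
  using tendsto_add by fastforce

lift_definition minus_c0 :: "c0 \<Rightarrow> c0 \<Rightarrow> c0" is "(-)"
  using tendsto_diff by fastforce

lift_definition uminus_c0 :: "c0 \<Rightarrow> c0" is uminus
  using tendsto_minus by fastforce

lift_definition scaleR_c0 :: "real \<Rightarrow> c0 \<Rightarrow> c0" is scaleR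
  using tendsto_mult_right_zero by fastforce

instance
  by standard (transfer, simp add: scaleR_add_right scaleR_add_left)+

end

instantiation c0 :: real_normed_vector
begin

lift_definition norm_c0 :: "c0 \<Rightarrow> real" is norm .

lift_definition dist_c0 :: "c0 \<Rightarrow> c0 \<Rightarrow> real" is dist .

definition sgn_c0 :: "c0 \<Rightarrow> c0"
  where "sgn_c0 x = x /\<^sub>R norm x"

definition uniformity_c0 :: "(c0 \<times> c0) filter"
  where "uniformity_c0 = (INF e\<in>{0 <..}. principal {(x, y). dist x y < e})"

definition open_c0 :: "c0 set \<Rightarrow> bool"
  where "open_c0 S = (\<forall>x\<in>S. \<forall>\<^sub>F (x', y) in uniformity. x' = x \<longrightarrow> y \<in> S)"

instance
proof
  fix a :: real and x y :: c0
  show "dist x y = norm (x - y)"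
    by transfer (simp add: dist_norm)
  show "norm x = 0 \<longleftrightarrow> x = 0"
    by transfer simp
  show "norm (x + y) \<le> norm x + norm y"
    by transfer (rule norm_triangle_ineq)
  show "norm (a *\<^sub>R x) = \<bar>a\<bar> * norm x"
    by transfer simp
qed (rule sgn_c0_def uniformity_c0_def open_c0_def)+

end

abbreviation c0_nth :: "c0 \<Rightarrow> nat \<Rightarrow> real"
  where "c0_nth x n \<equiv> apply_bcontfun (linfty_of_c0 x) n"

lemma c0_nth_simps [simp]:
  "c0_nth 0 n = 0"
  "c0_nth (x + y) n = c0_nth x n + c0_nth y n"
  "c0_nth (x - y) n = c0_nth x n - c0_nth y n"
  "c0_nth (- x) n = - c0_nth x n"
  "c0_nth (a *\<^sub>R x) n = a * c0_nth x n"
  by (transfer, simp)+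

lemma c0_nth_sum [simp]: "c0_nth (sum f A) n = (\<Sum>i\<in>A. c0_nth (f i) n)"
  by (induction A rule: infinite_finite_induct) auto

lemma c0_eqI: "(\<And>n. c0_nth x n = c0_nth y n) \<Longrightarrow> x = y"
  by transfer (auto intro: bcontfun_eqI)

lemma c0_tendsto: "c0_nth x \<longlonglongrightarrow> 0"
  by transfer simp

lemma abs_c0_nth_le: "\<bar>c0_nth x n\<bar> \<le> norm x"
  by transfer (metis norm_bounded real_norm_def)

lemma norm_c0_le: "(\<And>n. \<bar>c0_nth x n\<bar> \<le> b) \<Longrightarrow> norm x \<le> b"
  by transfer (simp add: norm_bound)

lemma bcontfun_nat_iff: "f \<in> bcontfun \<longleftrightarrow> bounded (range f)" for f :: "nat \<Rightarrow> real"
  by (simp add: bcontfun_def)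

lift_definition c0_unit :: "nat \<Rightarrow> c0"
  is "\<lambda>n. Bcontfun (\<lambda>k. if k = n then 1 else 0)"
proof -
  fix n :: nat
  have "(\<lambda>k. if k = n then 1 else 0 :: real) \<in> bcontfun"
    unfolding bcontfun_nat_iff by (rule boundedI[of _ 1]) auto
  moreover have "(\<lambda>k. if k = n then 1 else 0 :: real) \<longlonglongrightarrow> 0"
    by (rule tendsto_eventually) (auto simp: eventually_sequentially intro: exI[of _ "Suc n"])
  ultimately show "apply_bcontfun (Bcontfun (\<lambda>k. if k = n then 1 else 0)) \<longlonglongrightarrow> (0::real)"
    by (simp add: Bcontfun_inverse)
qed

lemma c0_nth_unit [simp]: "c0_nth (c0_unit n) k = (if k = n then 1 else 0)"
proof -
  have "(\<lambda>k. if k = n then 1 else 0 :: real) \<in> bcontfun"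
    unfolding bcontfun_nat_iff by (rule boundedI[of _ 1]) auto
  then show ?thesis
    by transfer (simp add: Bcontfun_inverse)
qed


section \<open>Equivalent norms, dual norms, almost square spaces\<close>

text \<open>A renorming of a space of type \<^typ>\<open>'a\<close> is represented by its norm, a function on
  \<^typ>\<open>'a\<close>. Since an equivalent norm has the same bounded functionals, the dual of every
  renorming has the underlying vector space \<^typ>\<open>'a \<Rightarrow>\<^sub>L real\<close>.\<close>

definition is_norm :: "('a::real_vector \<Rightarrow> real) \<Rightarrow> bool"
  where "is_norm N \<longleftrightarrow>
    (\<forall>x. N x = 0 \<longleftrightarrow> x = 0) \<and>
    (\<forall>x y. N (x + y) \<le> N x + N y) \<and>
    (\<forall>a x. N (a *\<^sub>R x) = \<bar>a\<bar> * N x)"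

definition equivalent_norm :: "('a::real_normed_vector \<Rightarrow> real) \<Rightarrow> bool"
  where "equivalent_norm N \<longleftrightarrow>
    is_norm N \<and> (\<exists>a>0. \<exists>b>0. \<forall>x. a * norm x \<le> N x \<and> N x \<le> b * norm x)"

text \<open>The supremum is a conditionally complete one on the reals; it is the dual norm whenever
  \<^term>\<open>N\<close> is an equivalent norm.\<close>

definition dual_norm :: "('a::real_normed_vector \<Rightarrow> real) \<Rightarrow> ('a \<Rightarrow>\<^sub>L real) \<Rightarrow> real"
  where "dual_norm N f = (SUP x\<in>{x. N x \<le> 1}. \<bar>blinfun_apply f x\<bar>)"

definition bidual_norm ::
    "('a::real_normed_vector \<Rightarrow> real) \<Rightarrow> (('a \<Rightarrow>\<^sub>L real) \<Rightarrow>\<^sub>L real) \<Rightarrow> real"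
  where "bidual_norm N = dual_norm (dual_norm N)"

definition almost_square :: "('a::real_vector \<Rightarrow> real) \<Rightarrow> bool"
  where "almost_square N \<longleftrightarrow>
    (\<forall>\<epsilon>>0. \<forall>F. finite F \<and> F \<subseteq> {x. N x = 1} \<longrightarrow>
      (\<exists>h. N h = 1 \<and> (\<forall>x\<in>F. N (x + h) \<le> 1 + \<epsilon> \<and> N (x - h) \<le> 1 + \<epsilon>)))"

lemma dual_norm_norm: "dual_norm norm = norm"
proof
  fix f :: "'a \<Rightarrow>\<^sub>L real"
  have le: "\<bar>f x\<bar> \<le> norm f" if "norm x \<le> 1" for x
    using norm_blinfun[of f x] mult_left_mono[OF that, of "norm f"] by simp
  have bdd: "bdd_above ((\<lambda>x. \<bar>f x\<bar>) ` {x. norm x \<le> 1})"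
    using le by (intro bdd_aboveI2[of _ _ "norm f"]) auto
  have up: "\<bar>f x\<bar> \<le> dual_norm norm f" if "norm x \<le> 1" for x
    unfolding dual_norm_def using bdd that by (intro cSUP_upper) auto
  show "dual_norm norm f = norm f"
  proof (rule antisym)
    show "dual_norm norm f \<le> norm f"
      unfolding dual_norm_def by (rule cSUP_least) (auto simp: le intro: exI[of _ 0])
    show "norm f \<le> dual_norm norm f"
    proof (rule norm_blinfun_bound)
      show "0 \<le> dual_norm norm f"
        using up[of 0] by simp
      fix x
      show "norm (f x) \<le> dual_norm norm f * norm x"
      proof (cases "x = 0")
        case False
        then show ?thesis
          using up[of "x /\<^sub>R norm x"]
          by (simp add: blinfun.scaleR_right abs_mult field_simps)
      qed simp
    qed
  qed
qed


section \<open>The identification of the bidual of c0\<close>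

lemma c0_dual_sum_le:
  fixes f :: "c0 \<Rightarrow>\<^sub>L real"
  shows "(\<Sum>n<k. \<bar>f (c0_unit n)\<bar>) \<le> norm f"
proof -
  define y where "y = (\<Sum>n<k. sgn (f (c0_unit n)) *\<^sub>R c0_unit n)"
  have "c0_nth y j = (if j < k then sgn (f (c0_unit j)) else 0)" for j
    by (simp add: y_def if_distrib cong: if_cong)
  then have y: "norm y \<le> 1"
    by (intro norm_c0_le) (simp add: sgn_real_def)
  have "f y = (\<Sum>n<k. \<bar>f (c0_unit n)\<bar>)"
    by (simp add: y_def blinfun.sum_right blinfun.scaleR_right abs_sgn mult.commute)
  then show ?thesis
    using norm_blinfun[of f y] mult_left_mono[OF y, of "norm f"] by simp
qed

lemma c0_dual_summable:
  fixes f :: "c0 \<Rightarrow>\<^sub>L real"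
  shows "summable (\<lambda>n. \<bar>f (c0_unit n)\<bar>)" "(\<Sum>n. \<bar>f (c0_unit n)\<bar>) \<le> norm f"
proof -
  show *: "summable (\<lambda>n. \<bar>f (c0_unit n)\<bar>)"
    by (rule bounded_imp_summable[of _ "norm f"])
      (use c0_dual_sum_le[of f "Suc _"] in \<open>auto simp: lessThan_Suc_atMost\<close>)
  show "(\<Sum>n. \<bar>f (c0_unit n)\<bar>) \<le> norm f"
    by (rule suminf_le_const[OF * c0_dual_sum_le])
qed

lemma linfty_nth_le: "\<bar>apply_bcontfun x n\<bar> \<le> norm x" for x :: linfty
  by (metis norm_bounded real_norm_def)

lemma linfty_dual_summable:
  fixes f :: "c0 \<Rightarrow>\<^sub>L real" and x :: linfty
  shows "summable (\<lambda>n. \<bar>f (c0_unit n) * x n\<bar>)" "summable (\<lambda>n. f (c0_unit n) * x n)"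
proof -
  show *: "summable (\<lambda>n. \<bar>f (c0_unit n) * x n\<bar>)"
    by (rule summable_comparison_test'[of "\<lambda>n. \<bar>f (c0_unit n)\<bar> * norm x" 0])
      (auto simp: abs_mult c0_dual_summable summable_mult2 intro: mult_left_mono linfty_nth_le)
  then show "summable (\<lambda>n. f (c0_unit n) * x n)"
    by (rule summable_rabs_cancel)
qed

lemma linfty_dual_le:
  fixes f :: "c0 \<Rightarrow>\<^sub>L real" and x :: linfty
  shows "\<bar>\<Sum>n. f (c0_unit n) * x n\<bar> \<le> norm f * norm x"
proof -
  have "\<bar>\<Sum>n. f (c0_unit n) * x n\<bar> \<le> (\<Sum>n. \<bar>f (c0_unit n) * x n\<bar>)"
    by (rule summable_rabs[OF linfty_dual_summable(1)])
  also have "\<dots> \<le> (\<Sum>n. \<bar>f (c0_unit n)\<bar> * norm x)"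
    by (intro suminf_le linfty_dual_summable summable_mult2 c0_dual_summable)
      (simp add: abs_mult mult_left_mono linfty_nth_le)
  also have "\<dots> = (\<Sum>n. \<bar>f (c0_unit n)\<bar>) * norm x"
    by (rule suminf_mult2[OF c0_dual_summable(1), symmetric])
  also have "\<dots> \<le> norm f * norm x"
    by (intro mult_right_mono c0_dual_summable) simp
  finally show ?thesis .
qed

text \<open>The canonical identification of the bounded sequences with the bidual of c0: a sequence
  \<open>x\<close> acts on the functional \<open>f\<close>, i.e. on the absolutely summable sequence
  \<open>n \<mapsto> f (c0_unit n)\<close>, by the usual pairing. The lemmas below show that it is an isometric linear
  bijection which extends the canonical embedding of c0 into its bidual.\<close>

lift_definition c0_bidual_of_linfty :: "linfty \<Rightarrow> ((c0 \<Rightarrow>\<^sub>L real) \<Rightarrow>\<^sub>L real)"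
  is "\<lambda>x f. \<Sum>n. blinfun_apply f (c0_unit n) * apply_bcontfun x n"
proof (rule bounded_linear_intro)
  fix x :: linfty and f g :: "c0 \<Rightarrow>\<^sub>L real" and a :: real
  show "(\<Sum>n. (f + g) (c0_unit n) * x n) = (\<Sum>n. f (c0_unit n) * x n) + (\<Sum>n. g (c0_unit n) * x n)"
    by (simp add: blinfun.add_left distrib_right suminf_add linfty_dual_summable)
  show "(\<Sum>n. (a *\<^sub>R f) (c0_unit n) * x n) = a *\<^sub>R (\<Sum>n. f (c0_unit n) * x n)"
    by (simp add: blinfun.scaleR_left mult.assoc suminf_mult linfty_dual_summable)
  show "norm (\<Sum>n. f (c0_unit n) * x n) \<le> norm f * norm x"
    using linfty_dual_le by simp
qed

lift_definition c0_coord :: "nat \<Rightarrow> (c0 \<Rightarrow>\<^sub>L real)" is "\<lambda>n x. c0_nth x n"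
  by (rule bounded_linear_intro[of _ 1]) (auto simp: abs_c0_nth_le)

lemma norm_c0_coord_le: "norm (c0_coord n) \<le> 1"
  by (rule norm_blinfun_bound) (auto simp: c0_coord.rep_eq abs_c0_nth_le)

lemma c0_bidual_of_linfty_coord: "c0_bidual_of_linfty x (c0_coord n) = apply_bcontfun x n"
proof -
  have "(\<lambda>k. c0_coord n (c0_unit k) * apply_bcontfun x k) =
      (\<lambda>k. if k = n then apply_bcontfun x n else 0)"
    by (auto simp: c0_coord.rep_eq)
  then show ?thesis
    using sums_single[of n "\<lambda>k. apply_bcontfun x n"]
    by (simp add: c0_bidual_of_linfty.rep_eq sums_iff)
qed

lemma norm_c0_bidual_of_linfty: "norm (c0_bidual_of_linfty x) = norm x"
proof (rule antisym)
  show "norm (c0_bidual_of_linfty x) \<le> norm x"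
    by (rule norm_blinfun_bound)
      (use linfty_dual_le in \<open>auto simp: c0_bidual_of_linfty.rep_eq mult.commute\<close>)
  show "norm x \<le> norm (c0_bidual_of_linfty x)"
  proof (rule norm_bound)
    fix n
    have "norm (x n) \<le> norm (c0_bidual_of_linfty x) * norm (c0_coord n)"
      using norm_blinfun[of "c0_bidual_of_linfty x" "c0_coord n"]
      by (simp add: c0_bidual_of_linfty_coord)
    also have "\<dots> \<le> norm (c0_bidual_of_linfty x)"
      using mult_left_mono[OF norm_c0_coord_le, of "norm (c0_bidual_of_linfty x)" n] by simp
    finally show "norm (x n) \<le> norm (c0_bidual_of_linfty x)" .
  qed
qed

lemma linear_c0_bidual_of_linfty: "linear c0_bidual_of_linfty"
proof (rule linearI; rule blinfun_eqI)
  fix x y :: linfty and f :: "c0 \<Rightarrow>\<^sub>L real" and a :: real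
  show "c0_bidual_of_linfty (x + y) f = (c0_bidual_of_linfty x + c0_bidual_of_linfty y) f"
    by (simp add: c0_bidual_of_linfty.rep_eq blinfun.add_left distrib_left suminf_add
        linfty_dual_summable)
  show "c0_bidual_of_linfty (a *\<^sub>R x) f = (a *\<^sub>R c0_bidual_of_linfty x) f"
    by (simp add: c0_bidual_of_linfty.rep_eq blinfun.scaleR_left mult.left_commute suminf_mult
        linfty_dual_summable)
qed

lemma c0_unit_sums:
  fixes y :: c0
  shows "(\<lambda>n. c0_nth y n *\<^sub>R c0_unit n) sums y"
  unfolding sums_def
proof (rule LIMSEQ_I)
  fix r :: real assume "r > 0"
  then obtain m where m: "\<And>n. n \<ge> m \<Longrightarrow> \<bar>c0_nth y n\<bar> < r / 2"
    using LIMSEQ_D[OF c0_tendsto[of y], of "r / 2"] by auto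
  have "norm ((\<Sum>i<k. c0_nth y i *\<^sub>R c0_unit i) - y) < r" if "k \<ge> m" for k
  proof -
    have "c0_nth ((\<Sum>i<k. c0_nth y i *\<^sub>R c0_unit i) - y) j = (if j < k then 0 else - c0_nth y j)" for j
      by (simp add: if_distrib cong: if_cong)
    then have "norm ((\<Sum>i<k. c0_nth y i *\<^sub>R c0_unit i) - y) \<le> r / 2"
      using m that \<open>r > 0\<close> by (intro norm_c0_le) (auto simp: less_imp_le)
    then show ?thesis using \<open>r > 0\<close> by simp
  qed
  then show "\<exists>no. \<forall>n\<ge>no. norm ((\<Sum>i<n. c0_nth y i *\<^sub>R c0_unit i) - y) < r"
    by blast
qed

lemma c0_dual_sums:
  fixes f :: "c0 \<Rightarrow>\<^sub>L real"
  shows "(\<lambda>n. f (c0_unit n) * c0_nth y n) sums f y"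
  using bounded_linear.sums[OF blinfun.bounded_linear_right c0_unit_sums[of y], of f]
  by (simp add: blinfun.scaleR_right mult.commute)

lemma c0_bidual_of_linfty_c0:
  "c0_bidual_of_linfty (linfty_of_c0 y) f = blinfun_apply f y"
  using c0_dual_sums[of f y] by (simp add: c0_bidual_of_linfty.rep_eq sums_iff)

lemma c0_coord_sums:
  fixes f :: "c0 \<Rightarrow>\<^sub>L real"
  shows "(\<lambda>n. f (c0_unit n) *\<^sub>R c0_coord n) sums f"
proof -
  have "norm (f (c0_unit n) *\<^sub>R c0_coord n) \<le> \<bar>f (c0_unit n)\<bar>" for n
    using mult_left_mono[OF norm_c0_coord_le, of "\<bar>f (c0_unit n)\<bar>" n] by simp
  then have "summable (\<lambda>n. f (c0_unit n) *\<^sub>R c0_coord n)"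
    by (intro summable_comparison_test'[OF c0_dual_summable(1)])
  then obtain g where g: "(\<lambda>n. f (c0_unit n) *\<^sub>R c0_coord n) sums g"
    by (auto simp: summable_def)
  have "g = f"
  proof (rule blinfun_eqI)
    fix y
    have "(\<lambda>n. f (c0_unit n) * c0_nth y n) sums g y"
      using bounded_linear.sums[OF blinfun.bounded_linear_left g, of y]
      by (simp add: blinfun.scaleR_left c0_coord.rep_eq)
    then show "g y = f y"
      using c0_dual_sums sums_unique2 by blast
  qed
  then show ?thesis using g by simp
qed

lemma bij_c0_bidual_of_linfty: "bij c0_bidual_of_linfty"
proof (rule bijI)
  show "inj c0_bidual_of_linfty"
    by (rule injI, rule bcontfun_eqI) (metis c0_bidual_of_linfty_coord)
  show "surj c0_bidual_of_linfty"
    unfolding surj_def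
  proof
    fix \<Phi> :: "(c0 \<Rightarrow>\<^sub>L real) \<Rightarrow>\<^sub>L real"
    have "\<bar>\<Phi> (c0_coord n)\<bar> \<le> norm \<Phi>" for n
      using norm_blinfun[of \<Phi> "c0_coord n"] mult_left_mono[OF norm_c0_coord_le, of "norm \<Phi>" n]
      by simp
    then have "(\<lambda>n. \<Phi> (c0_coord n)) \<in> bcontfun"
      unfolding bcontfun_nat_iff by (intro boundedI[of _ "norm \<Phi>"]) auto
    then obtain x where x: "(\<lambda>n. \<Phi> (c0_coord n)) = apply_bcontfun x"
      by (rule bcontfunE)
    have "\<Phi> f = c0_bidual_of_linfty x f" for f
      using bounded_linear.sums[OF blinfun.bounded_linear_right c0_coord_sums[of f], of \<Phi>]
      by (simp add: c0_bidual_of_linfty.rep_eq blinfun.scaleR_right sums_iff fun_cong[OF x, symmetric])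
    then show "\<exists>x. \<Phi> = c0_bidual_of_linfty x"
      by (auto intro: blinfun_eqI)
  qed
qed


section \<open>Bidual renormings\<close>

definition bidual_renorming_linfty :: "(linfty \<Rightarrow> real) \<Rightarrow> bool"
  where "bidual_renorming_linfty M \<longleftrightarrow>
    equivalent_norm M \<and>
    (\<exists>N :: c0 \<Rightarrow> real. equivalent_norm N \<and> (\<forall>x. M x = bidual_norm N (c0_bidual_of_linfty x)))"

end

theory Submission
  imports Defs
begin

text \<open>The norm is the supremum of \<open>\<bar>\<phi>(x)\<bar>\<close> over three families of finitely supported functionals
  \<open>\<phi>\<close> of \<open>\<ell>\<^sub>1\<close>-norm at most 1. Split the positive integers into the dyadic blocks
  \<open>[2^l, 2^(l+1))\<close>. The families are half of each coordinate; the averages over \<open>k\<close> coordinates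
  with arbitrary signs, taken one from each of \<open>k\<close> different blocks with numbers below \<open>k\<^sup>2\<close>;
  and, on block \<open>l\<close>, the \<open>l\<close> Rademacher coefficients. The first family alone makes the norm
  equivalent to the supremum norm, since \<open>\<parallel>x\<parallel>\<^sub>\<infinity> / 2 \<le> M x \<le> \<parallel>x\<parallel>\<^sub>\<infinity>\<close>.

  Any such supremum over functionals in the dual of c0 is at most the bidual norm of its
  restriction to c0. The two agree if the truncations of a sequence at some cofinal set of
  places do not increase the norm: a truncation lies in c0, and a functional in the dual unit
  ball takes at \<open>x\<close> the limit of its values at the truncations. Here truncating at a power of 2
  either keeps or deletes a whole block, so it keeps or deletes each Rademacher coefficient, and
  the other two families only see absolute values.

  For almost squareness, the perturbation \<open>h\<close> is a Rademacher sign vector \<open>r\<^sub>j\<close> on one block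
  \<open>l\<close>. Let finitely many \<open>x\<close> of norm 1 be given. Three conditions make \<open>x \<plusminus> h\<close> of norm at
  most \<open>1 + \<epsilon>\<close>.

  \<^item> The coordinates of \<open>x\<close> may be as large as 2, but they must be at most 1 on block \<open>l\<close>. The
  averages force this for most blocks: fewer than \<open>k\<close> of the blocks below \<open>k\<^sup>2\<close> are bad for a given
  \<open>x\<close>, so finitely many \<open>x\<close> cannot spoil all late blocks (\<open>exists_good_block\<close>).

  \<^item> An average that sees \<open>h\<close> must see it with a small weight. An average over \<open>k\<close> blocks
  uses block \<open>l\<close> only if \<open>l < k\<^sup>2\<close>, so the weight \<open>1/k\<close> is small when \<open>l\<close> is large.

  \<^item> The only Rademacher coefficient that sees \<open>h\<close> is the one of \<open>r\<^sub>j\<close> on block \<open>l\<close>, by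
  orthogonality, and it must be small at every given \<open>x\<close>. By the inequality of Bessel the squares of
  the \<open>l\<close> coefficients of each \<open>x\<close> sum to at most 1, so for large \<open>l\<close> some \<open>j\<close> works for all \<open>x\<close>
  (\<open>exists_small_rademacher_coeff\<close>).

  That same coefficient equals 1 at \<open>h\<close>, so \<open>h\<close> has norm 1.\<close>

section \<open>Norms given by a set of functionals on c0\<close>

definition sup_over :: "(c0 \<Rightarrow>\<^sub>L real) set \<Rightarrow> linfty \<Rightarrow> real"
  where "sup_over \<Phi> x = (SUP \<phi>\<in>\<Phi>. \<bar>c0_bidual_of_linfty x \<phi>\<bar>)"

definition truncation :: "nat \<Rightarrow> linfty \<Rightarrow> c0"
  where "truncation k x = (\<Sum>n<k. apply_bcontfun x n *\<^sub>R c0_unit n)"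

lemma c0_nth_truncation: "c0_nth (truncation k x) n = (if n < k then apply_bcontfun x n else 0)"
  by (simp add: truncation_def if_distrib cong: if_cong)

lemma tendsto_truncation:
  "(\<lambda>k. blinfun_apply g (truncation k x)) \<longlonglongrightarrow> c0_bidual_of_linfty x g"
proof -
  have "(\<lambda>n. g (c0_unit n) * apply_bcontfun x n) sums c0_bidual_of_linfty x g"
    using linfty_dual_summable(2) by (auto simp: c0_bidual_of_linfty.rep_eq intro: summable_sums)
  then show ?thesis
    by (simp add: sums_def truncation_def blinfun.sum_right blinfun.scaleR_right mult.commute)
qed

lemma c0_bidual_of_linfty_add:
  "c0_bidual_of_linfty (x + y) \<phi> = c0_bidual_of_linfty x \<phi> + c0_bidual_of_linfty y \<phi>"
  by (simp add: linear_add[OF linear_c0_bidual_of_linfty] blinfun.add_left)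

lemma c0_bidual_of_linfty_scaleR:
  "c0_bidual_of_linfty (a *\<^sub>R x) \<phi> = a * c0_bidual_of_linfty x \<phi>"
  by (simp add: linear_scale[OF linear_c0_bidual_of_linfty] blinfun.scaleR_left)

text \<open>A bounded set of functionals yields a norm equivalent to the supremum norm as soon as it
  contains a fixed positive multiple of every coordinate functional.\<close>

locale norming_functionals =
  fixes \<Phi> :: "(c0 \<Rightarrow>\<^sub>L real) set" and a :: real
  assumes norm_le_1: "\<phi> \<in> \<Phi> \<Longrightarrow> norm \<phi> \<le> 1"
    and a_pos: "a > 0"
    and coord_mem: "a *\<^sub>R c0_coord n \<in> \<Phi>"
begin

lemma nonempty: "\<Phi> \<noteq> {}"
  using coord_mem by auto

lemma abs_functional_le_norm: "\<phi> \<in> \<Phi> \<Longrightarrow> \<bar>c0_bidual_of_linfty x \<phi>\<bar> \<le> norm x"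
  using norm_blinfun[of "c0_bidual_of_linfty x" \<phi>] mult_left_mono[OF norm_le_1, of \<phi> "norm x"]
  by (simp add: norm_c0_bidual_of_linfty)

lemma sup_over_le_iff: "sup_over \<Phi> x \<le> c \<longleftrightarrow> (\<forall>\<phi>\<in>\<Phi>. \<bar>c0_bidual_of_linfty x \<phi>\<bar> \<le> c)"
  unfolding sup_over_def using nonempty abs_functional_le_norm
  by (intro cSUP_le_iff bdd_aboveI2[of _ _ "norm x"]) auto

lemma abs_functional_le: "\<phi> \<in> \<Phi> \<Longrightarrow> \<bar>c0_bidual_of_linfty x \<phi>\<bar> \<le> sup_over \<Phi> x"
  using sup_over_le_iff[of x "sup_over \<Phi> x"] by simp

lemma sup_over_le_norm: "sup_over \<Phi> x \<le> norm x"
  using abs_functional_le_norm by (simp add: sup_over_le_iff)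

lemma norm_le_sup_over: "a * norm x \<le> sup_over \<Phi> x"
proof -
  have "a * \<bar>apply_bcontfun x n\<bar> \<le> sup_over \<Phi> x" for n
    using abs_functional_le[OF coord_mem, of x n] a_pos
    by (simp add: blinfun.scaleR_right c0_bidual_of_linfty_coord abs_mult)
  then have "norm x \<le> sup_over \<Phi> x / a"
    using a_pos by (intro norm_bound) (simp add: field_simps)
  then show ?thesis
    using a_pos by (simp add: field_simps)
qed

lemma equivalent_norm_sup_over: "equivalent_norm (sup_over \<Phi>)"
proof -
  have nonneg: "0 \<le> sup_over \<Phi> x" for x
    using norm_le_sup_over[of x] a_pos by (meson mult_nonneg_nonneg less_imp_le norm_ge_zero order_trans)
  have zero: "sup_over \<Phi> x = 0 \<longleftrightarrow> x = 0" for x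
  proof
    assume "sup_over \<Phi> x = 0"
    then show "x = 0"
      using norm_le_sup_over[of x] a_pos by (simp add: mult_le_0_iff)
  next
    assume "x = 0"
    then show "sup_over \<Phi> x = 0"
      using nonneg[of 0] sup_over_le_norm[of 0] by simp
  qed
  have add: "sup_over \<Phi> (x + y) \<le> sup_over \<Phi> x + sup_over \<Phi> y" for x y
    unfolding sup_over_le_iff c0_bidual_of_linfty_add
    using abs_functional_le by (smt (verit))
  have scale_le: "sup_over \<Phi> (c *\<^sub>R x) \<le> \<bar>c\<bar> * sup_over \<Phi> x" for c x
    unfolding sup_over_le_iff c0_bidual_of_linfty_scaleR
    using abs_functional_le by (simp add: abs_mult mult_left_mono)
  have scale: "sup_over \<Phi> (c *\<^sub>R x) = \<bar>c\<bar> * sup_over \<Phi> x" for c x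
  proof (cases "c = 0")
    case True
    then show ?thesis using zero by simp
  next
    case False
    have "sup_over \<Phi> x \<le> \<bar>inverse c\<bar> * sup_over \<Phi> (c *\<^sub>R x)"
      using scale_le[of "inverse c" "c *\<^sub>R x"] False by simp
    then have "\<bar>c\<bar> * sup_over \<Phi> x \<le> sup_over \<Phi> (c *\<^sub>R x)"
      using False by (simp add: field_simps)
    then show ?thesis using scale_le[of c x] by simp
  qed
  show ?thesis
    unfolding equivalent_norm_def is_norm_def
    using zero add scale norm_le_sup_over a_pos sup_over_le_norm
    by (intro conjI exI[of _ a] exI[of _ 1]) auto
qed

lemma equivalent_norm_c0: "equivalent_norm (\<lambda>y. sup_over \<Phi> (linfty_of_c0 y))"
proof -
  have "linfty_of_c0 y = 0 \<longleftrightarrow> y = 0" for y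
    by transfer simp
  then show ?thesis
    using equivalent_norm_sup_over unfolding equivalent_norm_def is_norm_def
    by (simp add: plus_c0.rep_eq scaleR_c0.rep_eq norm_c0.rep_eq) metis
qed

text \<open>Each member of \<open>\<Phi>\<close> lies in the dual unit ball of the restricted norm, so the bidual norm
  dominates the supremum. Conversely, the value at \<open>x\<close> of a functional in that ball is a limit of its
  values at truncations of \<open>x\<close>. These are elements of c0, where the functional is bounded by the norm,
  and contractivity brings this bound back to \<open>x\<close>.\<close>

lemma bidual_norm_sup_over:
  fixes k :: "nat \<Rightarrow> nat"
  assumes "strict_mono k"
    and contractive: "\<And>x L. sup_over \<Phi> (linfty_of_c0 (truncation (k L) x)) \<le> sup_over \<Phi> x"
  shows "bidual_norm (\<lambda>y. sup_over \<Phi> (linfty_of_c0 y)) (c0_bidual_of_linfty x) = sup_over \<Phi> x"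
proof -
  define N where "N = (\<lambda>y. sup_over \<Phi> (linfty_of_c0 y))"
  have N: "N 0 = 0" "N (c *\<^sub>R y) = \<bar>c\<bar> * N y" "N y = 0 \<longleftrightarrow> y = 0" for c y
    using equivalent_norm_c0 unfolding equivalent_norm_def is_norm_def N_def by auto
  have norm_le_N: "a * norm y \<le> N y" for y
    using norm_le_sup_over[of "linfty_of_c0 y"] by (simp add: N_def norm_c0.rep_eq)
  have N_nonneg: "0 \<le> N y" for y
    using norm_le_N[of y] a_pos by (meson mult_nonneg_nonneg less_imp_le norm_ge_zero order_trans)
  have dual_ball: "\<bar>g y\<bar> \<le> N y" if "dual_norm N g \<le> 1" for g :: "c0 \<Rightarrow>\<^sub>L real" and y
  proof (cases "y = 0")
    case True
    then show ?thesis using N(1) by simp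
  next
    case False
    then have pos: "N y > 0"
      using N(3)[of y] N_nonneg[of y] by linarith
    have "bdd_above ((\<lambda>z. \<bar>g z\<bar>) ` {z. N z \<le> 1})"
    proof (intro bdd_aboveI2)
      fix z assume "z \<in> {z. N z \<le> 1}"
      then have "norm z \<le> 1 / a"
        using norm_le_N[of z] a_pos by (simp add: field_simps)
      then show "\<bar>g z\<bar> \<le> norm g * (1 / a)"
        using norm_blinfun[of g z] mult_left_mono[of "norm z" "1 / a" "norm g"] by simp
    qed
    then have "\<bar>g (y /\<^sub>R N y)\<bar> \<le> dual_norm N g"
      unfolding dual_norm_def using pos by (intro cSUP_upper) (auto simp: N(2))
    then have "\<bar>g (y /\<^sub>R N y)\<bar> \<le> 1"
      using that by simp
    then show ?thesis
      using pos by (simp add: blinfun.scaleR_right abs_mult field_simps)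
  qed
  have functional_in_dual_ball: "dual_norm N \<phi> \<le> 1" if "\<phi> \<in> \<Phi>" for \<phi>
    unfolding dual_norm_def
  proof (rule cSUP_least)
    show "{y. N y \<le> 1} \<noteq> {}"
      using N(1) by (auto intro: exI[of _ 0])
    fix y assume "y \<in> {y. N y \<le> 1}"
    then show "\<bar>\<phi> y\<bar> \<le> 1"
      using abs_functional_le[OF that, of "linfty_of_c0 y"]
      by (simp add: N_def c0_bidual_of_linfty_c0)
  qed
  have le: "\<bar>c0_bidual_of_linfty x g\<bar> \<le> sup_over \<Phi> x" if "dual_norm N g \<le> 1" for g
  proof (rule LIMSEQ_le_const2)
    show "(\<lambda>L. \<bar>g (truncation (k L) x)\<bar>) \<longlonglongrightarrow> \<bar>c0_bidual_of_linfty x g\<bar>"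
      using LIMSEQ_subseq_LIMSEQ[OF tendsto_truncation \<open>strict_mono k\<close>, of g x]
      by (intro tendsto_rabs) (simp add: o_def)
    have "\<bar>g (truncation (k L) x)\<bar> \<le> sup_over \<Phi> x" for L
      using dual_ball[OF that, of "truncation (k L) x"] contractive[of L x]
      by (simp add: N_def)
    then show "\<exists>n. \<forall>L\<ge>n. \<bar>g (truncation (k L) x)\<bar> \<le> sup_over \<Phi> x"
      by blast
  qed
  have "bidual_norm N (c0_bidual_of_linfty x) = sup_over \<Phi> x"
  proof (rule antisym)
    obtain \<phi> where "\<phi> \<in> \<Phi>"
      using nonempty by blast
    then show "bidual_norm N (c0_bidual_of_linfty x) \<le> sup_over \<Phi> x"
      unfolding bidual_norm_def dual_norm_def[of "dual_norm N"]
      using functional_in_dual_ball le by (intro cSUP_least) auto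
    show "sup_over \<Phi> x \<le> bidual_norm N (c0_bidual_of_linfty x)"
      unfolding sup_over_le_iff
    proof
      fix \<phi> assume "\<phi> \<in> \<Phi>"
      then show "\<bar>c0_bidual_of_linfty x \<phi>\<bar> \<le> bidual_norm N (c0_bidual_of_linfty x)"
        unfolding bidual_norm_def dual_norm_def[of "dual_norm N"]
        using functional_in_dual_ball le
        by (intro cSUP_upper bdd_aboveI2[of _ _ "sup_over \<Phi> x"]) auto
    qed
  qed
  then show ?thesis
    by (simp add: N_def)
qed

end


section \<open>Rademacher signs on dyadic blocks\<close>

definition block :: "nat \<Rightarrow> nat set"
  where "block l = {2 ^ l..<2 ^ Suc l}"

lemma finite_block [simp]: "finite (block l)"
  and card_block: "card (block l) = 2 ^ l"
  by (simp_all add: block_def)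

lemma block_disjoint:
  assumes "v \<in> block l" "v \<in> block l'"
  shows "l = l'"
proof -
  have "\<not> l < l'" if "v \<in> block l" "v \<in> block l'" for l l'
  proof
    assume "l < l'"
    then have "(2::nat) ^ Suc l \<le> 2 ^ l'"
      by (intro power_increasing) auto
    then show False
      using that by (auto simp: block_def)
  qed
  then show ?thesis
    using assms by (meson linorder_neqE_nat)
qed

text \<open>Block \<open>l\<close> consists of the numbers with leading binary digit at place \<open>l\<close>. In this form it is
  clear that the block is stable under changes of lower digits.\<close>

lemma mem_block_iff: "v \<in> block l \<longleftrightarrow> drop_bit l v = 1"
proof -
  have "drop_bit l v = 1 \<longleftrightarrow> 1 \<le> v div 2 ^ l \<and> v div 2 ^ l < 2"
    by (auto simp: drop_bit_eq_div)
  also have "\<dots> \<longleftrightarrow> v \<in> block l"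
    by (simp add: block_def less_eq_div_iff_mult_less_eq div_less_iff_less_mult)
  finally show ?thesis by simp
qed

definition rademacher :: "nat \<Rightarrow> nat \<Rightarrow> real"
  where "rademacher j v = (if bit v j then -1 else 1)"

lemma abs_rademacher [simp]: "\<bar>rademacher j v\<bar> = 1"
  and rademacher_mult_self [simp]: "rademacher j v * rademacher j v = 1"
  by (simp_all add: rademacher_def)

text \<open>Flipping the binary digit \<open>j\<close> permutes the block, reverses the sign of the \<open>j\<close>-th Rademacher
  function and fixes the \<open>i\<close>-th one, so the sum equals its negative.\<close>

lemma sum_rademacher_mult:
  assumes "i < l" "j < l" "i \<noteq> j"
  shows "(\<Sum>v\<in>block l. rademacher i v * rademacher j v) = 0"
proof -
  have flip_mem: "flip_bit j v \<in> block l" if "v \<in> block l" for v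
  proof -
    have "drop_bit l (flip_bit j v) = drop_bit l v"
      using \<open>j < l\<close> by (intro bit_eqI) (simp add: bit_drop_bit_eq bit_flip_bit_iff)
    then show ?thesis
      using that by (simp add: mem_block_iff)
  qed
  have flip_flip: "flip_bit j (flip_bit j v) = v" for v :: nat
    by (intro bit_eqI) (auto simp: bit_flip_bit_iff)
  have "(\<Sum>v\<in>block l. rademacher i v * rademacher j v) =
      (\<Sum>v\<in>block l. rademacher i (flip_bit j v) * rademacher j (flip_bit j v))"
    by (rule sum.reindex_bij_witness[of _ "flip_bit j" "flip_bit j"])
      (auto simp: flip_mem flip_flip)
  also have "\<dots> = (\<Sum>v\<in>block l. - (rademacher i v * rademacher j v))"
    using \<open>i \<noteq> j\<close> by (intro sum.cong) (auto simp: rademacher_def bit_flip_bit_iff)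
  finally show ?thesis
    by (simp add: sum_negf)
qed

definition rademacher_coeff :: "nat \<Rightarrow> nat \<Rightarrow> (nat \<Rightarrow> real) \<Rightarrow> real"
  where "rademacher_coeff l j x = (\<Sum>v\<in>block l. rademacher j v * x v) / 2 ^ l"

lemma rademacher_coeff_rademacher:
  assumes "i < l" "j < l"
  shows "rademacher_coeff l i (rademacher j) = (if i = j then 1 else 0)"
  using assms by (simp add: rademacher_coeff_def sum_rademacher_mult card_block)

lemma abs_rademacher_coeff_le:
  assumes "\<And>v. v \<in> block l \<Longrightarrow> \<bar>x v\<bar> \<le> c"
  shows "\<bar>rademacher_coeff l j x\<bar> \<le> c"
proof -
  have "\<bar>\<Sum>v\<in>block l. rademacher j v * x v\<bar> \<le> (\<Sum>v\<in>block l. c)"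
    using assms by (intro order_trans[OF sum_abs] sum_mono) (simp add: abs_mult)
  then show ?thesis
    by (simp add: rademacher_coeff_def card_block field_simps)
qed

text \<open>This is the inequality of Bessel for the normalized counting measure on a block, obtained by
  comparing \<open>x\<close> with its projection \<open>y\<close> to the span of the Rademacher functions.\<close>

lemma bessel_rademacher:
  assumes "\<And>v. v \<in> block l \<Longrightarrow> \<bar>x v\<bar> \<le> 1"
  shows "(\<Sum>j<l. (rademacher_coeff l j x)\<^sup>2) \<le> 1"
proof -
  define c where "c j = rademacher_coeff l j x" for j
  define y where "y v = (\<Sum>j<l. c j * rademacher j v)" for v
  have xy: "(\<Sum>v\<in>block l. x v * y v) = 2 ^ l * (\<Sum>j<l. (c j)\<^sup>2)"
  proof -
    have "(\<Sum>v\<in>block l. x v * y v) = (\<Sum>j<l. c j * (\<Sum>v\<in>block l. rademacher j v * x v))"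
      unfolding y_def sum_distrib_left by (subst sum.swap) (simp add: mult_ac)
    also have "\<dots> = (\<Sum>j<l. c j * (2 ^ l * c j))"
      by (simp add: c_def rademacher_coeff_def)
    finally show ?thesis
      by (simp add: sum_distrib_left power2_eq_square mult_ac)
  qed
  have yy: "(\<Sum>v\<in>block l. y v * y v) = 2 ^ l * (\<Sum>j<l. (c j)\<^sup>2)"
  proof -
    have "(\<Sum>v\<in>block l. y v * y v) =
        (\<Sum>v\<in>block l. \<Sum>j<l. \<Sum>i<l. c i * c j * (rademacher i v * rademacher j v))"
      unfolding y_def sum_product by (subst sum.swap) (simp add: mult_ac)
    also have "\<dots> = (\<Sum>j<l. \<Sum>v\<in>block l. \<Sum>i<l. c i * c j * (rademacher i v * rademacher j v))"
      by (rule sum.swap)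
    also have "\<dots> = (\<Sum>j<l. \<Sum>i<l. \<Sum>v\<in>block l. c i * c j * (rademacher i v * rademacher j v))"
      by (intro sum.cong refl sum.swap)
    also have "\<dots> = (\<Sum>j<l. \<Sum>i<l. if i = j then 2 ^ l * (c j)\<^sup>2 else 0)"
      by (intro sum.cong refl)
        (auto simp: sum_rademacher_mult card_block power2_eq_square simp flip: sum_distrib_left)
    finally show ?thesis
      by (simp add: sum_distrib_left)
  qed
  have "0 \<le> (\<Sum>v\<in>block l. (x v - y v)\<^sup>2)"
    by (intro sum_nonneg) simp
  also have "\<dots> = (\<Sum>v\<in>block l. (x v)\<^sup>2) - 2 * (\<Sum>v\<in>block l. x v * y v) + (\<Sum>v\<in>block l. y v * y v)"
    by (simp add: power2_eq_square algebra_simps sum.distrib sum_subtractf sum_distrib_left)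
  also have "\<dots> \<le> 2 ^ l - 2 ^ l * (\<Sum>j<l. (c j)\<^sup>2)"
  proof -
    have "(\<Sum>v\<in>block l. (x v)\<^sup>2) \<le> (\<Sum>v\<in>block l. 1)"
      using assms by (intro sum_mono) (simp add: abs_square_le_1)
    then show ?thesis
      by (simp add: xy yy card_block)
  qed
  finally show ?thesis
    by (simp add: c_def)
qed


section \<open>The almost square norm\<close>

definition coord_functionals :: "(c0 \<Rightarrow>\<^sub>L real) set"
  where "coord_functionals = range (\<lambda>n. (1 / 2) *\<^sub>R c0_coord n)"

text \<open>The quadratic bound balances two demands on averages over blocks with numbers in \<open>F\<close>. It
  leaves so much room that fewer than \<open>card F\<close> bad blocks among the first \<open>(card F)\<^sup>2\<close> are a
  vanishing proportion; and it lets a late block belong only to large sets \<open>F\<close>, in whose averages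
  it has a small weight.\<close>

definition admissible :: "nat set \<Rightarrow> bool"
  where "admissible F \<longleftrightarrow> finite F \<and> F \<noteq> {} \<and> F \<subseteq> {..<(card F)\<^sup>2}"

definition average_functionals :: "(c0 \<Rightarrow>\<^sub>L real) set"
  where "average_functionals =
    {(1 / real (card F)) *\<^sub>R (\<Sum>l\<in>F. s l *\<^sub>R c0_coord (v l)) | F s v.
      admissible F \<and> (\<forall>l\<in>F. v l \<in> block l \<and> \<bar>s l\<bar> = 1)}"

definition rademacher_functionals :: "(c0 \<Rightarrow>\<^sub>L real) set"
  where "rademacher_functionals =
    {(1 / 2 ^ l) *\<^sub>R (\<Sum>v\<in>block l. rademacher j v *\<^sub>R c0_coord v) | l j. j < l}"

abbreviation square_functionals :: "(c0 \<Rightarrow>\<^sub>L real) set"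
  where "square_functionals \<equiv> coord_functionals \<union> average_functionals \<union> rademacher_functionals"

lemma norm_scaled_sum_coord_le:
  assumes "finite A" "\<And>i. i \<in> A \<Longrightarrow> \<bar>s i\<bar> = 1"
  shows "norm ((1 / real (card A)) *\<^sub>R (\<Sum>i\<in>A. s i *\<^sub>R c0_coord (v i))) \<le> 1"
proof -
  have "norm (\<Sum>i\<in>A. s i *\<^sub>R c0_coord (v i)) \<le> (\<Sum>i\<in>A. 1)"
    using assms norm_c0_coord_le by (intro order_trans[OF norm_sum] sum_mono) simp
  then show ?thesis
    using assms(1) by (cases "A = {}") (simp_all add: field_simps card_gt_0_iff)
qed

interpretation square: norming_functionals square_functionals "1 / 2"
proof
  fix \<phi> assume "\<phi> \<in> square_functionals"
  then show "norm \<phi> \<le> 1"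
  proof (elim UnE)
    assume "\<phi> \<in> coord_functionals"
    then obtain n where "\<phi> = (1 / 2) *\<^sub>R c0_coord n"
      by (auto simp: coord_functionals_def)
    then show ?thesis
      using norm_c0_coord_le[of n] by simp
  next
    assume "\<phi> \<in> average_functionals"
    then show ?thesis
      by (auto simp: average_functionals_def admissible_def intro!: norm_scaled_sum_coord_le
          simp del: norm_scaleR)
  next
    assume "\<phi> \<in> rademacher_functionals"
    then obtain l j where "\<phi> = (1 / real (card (block l))) *\<^sub>R (\<Sum>v\<in>block l. rademacher j v *\<^sub>R c0_coord v)"
      by (auto simp: rademacher_functionals_def card_block)
    then show ?thesis
      by (auto intro!: norm_scaled_sum_coord_le simp del: norm_scaleR)
  qed
qed (auto simp: coord_functionals_def)

abbreviation square_norm :: "linfty \<Rightarrow> real"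
  where "square_norm \<equiv> sup_over square_functionals"

text \<open>The free choice of signs in the averages turns their bound into one on sums of absolute
  values.\<close>

lemma square_norm_le_iff:
  "square_norm x \<le> c \<longleftrightarrow>
    (\<forall>n. \<bar>apply_bcontfun x n\<bar> \<le> 2 * c) \<and>
    (\<forall>F v. admissible F \<and> (\<forall>l\<in>F. v l \<in> block l) \<longrightarrow>
      (\<Sum>l\<in>F. \<bar>apply_bcontfun x (v l)\<bar>) \<le> real (card F) * c) \<and>
    (\<forall>l. \<forall>j<l. \<bar>rademacher_coeff l j x\<bar> \<le> c)"
  (is "_ \<longleftrightarrow> ?coord \<and> ?average \<and> ?rademacher")
proof -
  have "(\<forall>\<phi>\<in>coord_functionals. \<bar>c0_bidual_of_linfty x \<phi>\<bar> \<le> c) \<longleftrightarrow> ?coord"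
    by (auto simp: coord_functionals_def blinfun.scaleR_right c0_bidual_of_linfty_coord abs_mult
        mult.commute[of c])
  moreover have "(\<forall>\<phi>\<in>average_functionals. \<bar>c0_bidual_of_linfty x \<phi>\<bar> \<le> c) \<longleftrightarrow> ?average"
  proof -
    define G where "G F s v = (1 / real (card F)) *\<^sub>R (\<Sum>l\<in>F. s l *\<^sub>R c0_coord (v l))"
      for F :: "nat set" and s :: "nat \<Rightarrow> real" and v :: "nat \<Rightarrow> nat"
    have G: "\<bar>c0_bidual_of_linfty x (G F s v)\<bar> = \<bar>\<Sum>l\<in>F. s l * apply_bcontfun x (v l)\<bar> / real (card F)"
      for F s v
      by (simp add: G_def blinfun.scaleR_right blinfun.sum_right c0_bidual_of_linfty_coord abs_mult)
    have pos: "real (card F) > 0" if "admissible F" for F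
      using that by (simp add: admissible_def card_gt_0_iff)
    have "(\<forall>\<phi>\<in>average_functionals. \<bar>c0_bidual_of_linfty x \<phi>\<bar> \<le> c) \<longleftrightarrow>
        (\<forall>F s v. admissible F \<and> (\<forall>l\<in>F. v l \<in> block l \<and> \<bar>s l\<bar> = 1) \<longrightarrow>
          \<bar>c0_bidual_of_linfty x (G F s v)\<bar> \<le> c)"
    proof (intro iffI ballI allI impI)
      fix F v and s :: "nat \<Rightarrow> real"
      assume *: "\<forall>\<phi>\<in>average_functionals. \<bar>c0_bidual_of_linfty x \<phi>\<bar> \<le> c"
        and "admissible F \<and> (\<forall>l\<in>F. v l \<in> block l \<and> \<bar>s l\<bar> = 1)"
      then have "G F s v \<in> average_functionals"
        unfolding average_functionals_def G_def by blast
      with * show "\<bar>c0_bidual_of_linfty x (G F s v)\<bar> \<le> c"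
        by (rule bspec)
    next
      fix \<phi>
      assume *: "\<forall>F s v. admissible F \<and> (\<forall>l\<in>F. v l \<in> block l \<and> \<bar>s l\<bar> = 1) \<longrightarrow>
          \<bar>c0_bidual_of_linfty x (G F s v)\<bar> \<le> c"
        and "\<phi> \<in> average_functionals"
      then obtain F s v where "\<phi> = G F s v"
          "admissible F \<and> (\<forall>l\<in>F. v l \<in> block l \<and> \<bar>s l\<bar> = 1)"
        unfolding average_functionals_def G_def by blast
      with * show "\<bar>c0_bidual_of_linfty x \<phi>\<bar> \<le> c"
        by simp
    qed
    also have "\<dots> \<longleftrightarrow> ?average"
    proof (intro iffI allI impI)
      fix F v
      assume *: "\<forall>F s v. admissible F \<and> (\<forall>l\<in>F. v l \<in> block l \<and> \<bar>s l\<bar> = 1) \<longrightarrow>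
          \<bar>c0_bidual_of_linfty x (G F s v)\<bar> \<le> c"
        and F: "admissible F \<and> (\<forall>l\<in>F. v l \<in> block l)"
      define s where "s l = (if apply_bcontfun x (v l) < 0 then - 1 else 1 :: real)" for l
      have "\<bar>\<Sum>l\<in>F. s l * apply_bcontfun x (v l)\<bar> / real (card F) \<le> c"
        using *[rule_format, of F v s] F by (simp add: G s_def)
      moreover have "s l * apply_bcontfun x (v l) = \<bar>apply_bcontfun x (v l)\<bar>" for l
        by (simp add: s_def)
      ultimately show "(\<Sum>l\<in>F. \<bar>apply_bcontfun x (v l)\<bar>) \<le> real (card F) * c"
        using pos[of F] F by (simp add: sum_nonneg field_simps)
    next
      fix F v and s :: "nat \<Rightarrow> real"
      assume *: ?average and F: "admissible F \<and> (\<forall>l\<in>F. v l \<in> block l \<and> \<bar>s l\<bar> = 1)"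
      have "\<bar>\<Sum>l\<in>F. s l * apply_bcontfun x (v l)\<bar> \<le> (\<Sum>l\<in>F. \<bar>apply_bcontfun x (v l)\<bar>)"
        using F by (intro order_trans[OF sum_abs] sum_mono) (simp add: abs_mult)
      also have "\<dots> \<le> real (card F) * c"
        using * F by blast
      finally show "\<bar>c0_bidual_of_linfty x (G F s v)\<bar> \<le> c"
        using pos[of F] F by (simp add: G field_simps)
    qed
    finally show ?thesis .
  qed
  moreover have "(\<forall>\<phi>\<in>rademacher_functionals. \<bar>c0_bidual_of_linfty x \<phi>\<bar> \<le> c) \<longleftrightarrow> ?rademacher"
  proof -
    define R where "R l j = (1 / 2 ^ l) *\<^sub>R (\<Sum>v\<in>block l. rademacher j v *\<^sub>R c0_coord v)" for l j
    have R: "c0_bidual_of_linfty x (R l j) = rademacher_coeff l j x" for l j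
      by (simp add: R_def rademacher_coeff_def blinfun.scaleR_right blinfun.sum_right
          c0_bidual_of_linfty_coord)
    have eq: "rademacher_functionals = (\<Union>l. R l ` {..<l})"
      unfolding rademacher_functionals_def R_def by blast
    show ?thesis
      unfolding eq by (auto simp: R)
  qed
  ultimately show ?thesis
    unfolding square.sup_over_le_iff ball_Un by simp
qed

text \<open>The cut at a power of 2 matters for the Rademacher coefficients: a cut inside a block could
  destroy a cancellation and increase a coefficient.\<close>

lemma square_norm_truncation_le:
  "square_norm (linfty_of_c0 (truncation (2 ^ L) x)) \<le> square_norm x"
proof -
  define c where "c = square_norm x"
  have x: "\<bar>apply_bcontfun x n\<bar> \<le> 2 * c"
      "admissible F \<Longrightarrow> (\<forall>l\<in>F. v l \<in> block l) \<Longrightarrow>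
        (\<Sum>l\<in>F. \<bar>apply_bcontfun x (v l)\<bar>) \<le> real (card F) * c"
      "j < l \<Longrightarrow> \<bar>rademacher_coeff l j x\<bar> \<le> c" for n F v l j
    using square_norm_le_iff[of x c] by (auto simp: c_def)
  have c: "0 \<le> c"
    using x(1)[of 0] by linarith
  have le: "\<bar>c0_nth (truncation (2 ^ L) x) n\<bar> \<le> \<bar>apply_bcontfun x n\<bar>" for n
    by (simp add: c0_nth_truncation)
  have coeff: "\<bar>rademacher_coeff l j (c0_nth (truncation (2 ^ L) x))\<bar> \<le> c" if "j < l" for l j
  proof (cases "l < L")
    case True
    then have "(2::nat) ^ Suc l \<le> 2 ^ L"
      by (intro power_increasing) auto
    then have "rademacher_coeff l j (c0_nth (truncation (2 ^ L) x)) = rademacher_coeff l j x"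
      unfolding rademacher_coeff_def
      by (intro arg_cong2[of _ _ _ _ "(/)"] sum.cong) (auto simp: block_def c0_nth_truncation)
    then show ?thesis
      using x(3)[OF that] by simp
  next
    case False
    then have ge: "(2::nat) ^ L \<le> 2 ^ l"
      by (intro power_increasing) auto
    have "c0_nth (truncation (2 ^ L) x) v = 0" if "v \<in> block l" for v
    proof -
      have "2 ^ l \<le> v"
        using that by (simp add: block_def)
      with ge have "2 ^ L \<le> v"
        by (rule order_trans)
      then show ?thesis
        by (simp add: c0_nth_truncation)
    qed
    then have "rademacher_coeff l j (c0_nth (truncation (2 ^ L) x)) = 0"
      by (simp add: rademacher_coeff_def)
    then show ?thesis
      using c by simp
  qed
  have "(\<Sum>l\<in>F. \<bar>c0_nth (truncation (2 ^ L) x) (v l)\<bar>) \<le> real (card F) * c"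
    if "admissible F" "\<forall>l\<in>F. v l \<in> block l" for F v
    by (rule order_trans[OF sum_mono x(2)[OF that]]) (rule le)
  then show ?thesis
    unfolding c_def[symmetric] square_norm_le_iff
    using coeff order_trans[OF le x(1)] by blast
qed


section \<open>Almost squareness\<close>

text \<open>On a bad block there is no room to add a vector of signs: half of a coordinate could then
  exceed 1.\<close>

definition bad_blocks :: "linfty \<Rightarrow> nat set"
  where "bad_blocks x = {l. \<exists>v\<in>block l. \<bar>apply_bcontfun x v\<bar> > 1}"

text \<open>Otherwise \<open>k\<close> bad blocks would form an admissible set, and the average of coordinates larger
  than 1, one from each of them, would exceed 1.\<close>

lemma card_bad_blocks_less:
  assumes "square_norm x \<le> 1" "k > 0"
  shows "card (bad_blocks x \<inter> {..<k\<^sup>2}) < k"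
proof (rule ccontr)
  assume "\<not> ?thesis"
  then obtain F where F: "F \<subseteq> bad_blocks x \<inter> {..<k\<^sup>2}" "card F = k" "finite F"
    by (meson obtain_subset_with_card_n not_less)
  then have "\<forall>l\<in>F. \<exists>v. v \<in> block l \<and> \<bar>apply_bcontfun x v\<bar> > 1"
    by (auto simp: bad_blocks_def)
  then obtain v where v: "\<And>l. l \<in> F \<Longrightarrow> v l \<in> block l \<and> \<bar>apply_bcontfun x (v l)\<bar> > 1"
    by metis
  have "admissible F"
    using F \<open>k > 0\<close> by (auto simp: admissible_def)
  then have "(\<Sum>l\<in>F. \<bar>apply_bcontfun x (v l)\<bar>) \<le> real (card F) * 1"
    using assms(1) v unfolding square_norm_le_iff by blast
  moreover have "(\<Sum>l\<in>F. \<bar>apply_bcontfun x (v l)\<bar>) > (\<Sum>l\<in>F. 1)"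
    using v F \<open>k > 0\<close> by (intro sum_strict_mono) auto
  ultimately show False
    by simp
qed

text \<open>The bad blocks below \<open>k\<^sup>2\<close> number at most \<open>k * card X\<close>, which together with the first \<open>m\<close>
  blocks is less than \<open>k\<^sup>2\<close> once \<open>k > card X + m\<close>.\<close>

lemma exists_good_block:
  assumes "finite X" "\<And>x. x \<in> X \<Longrightarrow> square_norm x \<le> 1"
  shows "\<exists>l\<ge>m. \<forall>x\<in>X. l \<notin> bad_blocks x"
proof (rule ccontr)
  assume none: "\<not> ?thesis"
  define k where "k = card X + m + 1"
  have "{..<k\<^sup>2} \<subseteq> {..<m} \<union> (\<Union>x\<in>X. bad_blocks x \<inter> {..<k\<^sup>2})"
    using none by (auto simp: not_less)
  then have "card {..<k\<^sup>2} \<le> card ({..<m} \<union> (\<Union>x\<in>X. bad_blocks x \<inter> {..<k\<^sup>2}))"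
    using assms(1) by (intro card_mono) auto
  also have "\<dots> \<le> m + card (\<Union>x\<in>X. bad_blocks x \<inter> {..<k\<^sup>2})"
    using card_Un_le[of "{..<m}"] by simp
  also have "card (\<Union>x\<in>X. bad_blocks x \<inter> {..<k\<^sup>2}) \<le> (\<Sum>x\<in>X. card (bad_blocks x \<inter> {..<k\<^sup>2}))"
    by (rule card_UN_le[OF assms(1)])
  also have "\<dots> \<le> (\<Sum>x\<in>X. k)"
  proof (rule sum_mono)
    fix x assume "x \<in> X"
    then show "card (bad_blocks x \<inter> {..<k\<^sup>2}) \<le> k"
      using card_bad_blocks_less[OF assms(2), of x k] by (simp add: k_def)
  qed
  finally have "k * k \<le> m + card X * k"
    by (simp add: power2_eq_square)
  moreover have "k * k = card X * k + m * k + k"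
    by (simp add: k_def algebra_simps)
  moreover have "m * k \<ge> m" "k > 0"
    by (simp_all add: k_def)
  ultimately show False
    by linarith
qed

text \<open>Summed over \<open>X\<close>, the squared coefficients total at most \<open>card X\<close> by the inequality of Bessel.
  If every \<open>j\<close> had a coefficient above \<open>\<epsilon>\<close>, they would total at least \<open>l * \<epsilon>\<^sup>2\<close>.\<close>

lemma exists_small_rademacher_coeff:
  fixes X :: "linfty set"
  assumes "finite X" "\<And>x. x \<in> X \<Longrightarrow> l \<notin> bad_blocks x" "\<epsilon> > 0" "real (card X) < real l * \<epsilon>\<^sup>2"
  shows "\<exists>j<l. \<forall>x\<in>X. \<bar>rademacher_coeff l j (apply_bcontfun x)\<bar> \<le> \<epsilon>"
proof (rule ccontr)
  assume none: "\<not> ?thesis"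
  have "\<epsilon>\<^sup>2 \<le> (\<Sum>x\<in>X. (rademacher_coeff l j (apply_bcontfun x))\<^sup>2)" if j: "j < l" for j
  proof -
    obtain x where x: "x \<in> X" "\<epsilon> < \<bar>rademacher_coeff l j (apply_bcontfun x)\<bar>"
      using none j by (meson not_le)
    then have "\<epsilon>\<^sup>2 \<le> (rademacher_coeff l j (apply_bcontfun x))\<^sup>2"
      using power_mono[of \<epsilon> "\<bar>rademacher_coeff l j (apply_bcontfun x)\<bar>" 2] \<open>\<epsilon> > 0\<close> by simp
    also have "\<dots> \<le> (\<Sum>x\<in>X. (rademacher_coeff l j (apply_bcontfun x))\<^sup>2)"
      by (rule member_le_sum) (use x assms(1) in auto)
    finally show ?thesis .
  qed
  then have "(\<Sum>j<l. \<epsilon>\<^sup>2) \<le> (\<Sum>j<l. \<Sum>x\<in>X. (rademacher_coeff l j (apply_bcontfun x))\<^sup>2)"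
    by (intro sum_mono) simp
  also have "\<dots> = (\<Sum>x\<in>X. \<Sum>j<l. (rademacher_coeff l j (apply_bcontfun x))\<^sup>2)"
    by (rule sum.swap)
  also have "\<dots> \<le> (\<Sum>x\<in>X. 1)"
    using assms(2) by (intro sum_mono bessel_rademacher) (auto simp: bad_blocks_def not_less)
  finally show False
    using assms(4) by simp
qed

definition block_sign :: "nat \<Rightarrow> nat \<Rightarrow> linfty"
  where "block_sign l j = Bcontfun (\<lambda>v. if v \<in> block l then rademacher j v else 0)"

lemma block_sign_nth:
  "apply_bcontfun (block_sign l j) v = (if v \<in> block l then rademacher j v else 0)"
proof -
  have "(\<lambda>v. if v \<in> block l then rademacher j v else 0) \<in> bcontfun"
    unfolding bcontfun_nat_iff by (rule boundedI[of _ 1]) auto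
  then show ?thesis
    by (simp add: block_sign_def Bcontfun_inverse)
qed

lemma rademacher_coeff_block_sign:
  assumes "i < l'" "j < l"
  shows "rademacher_coeff l' i (block_sign l j) = (if l' = l \<and> i = j then 1 else 0)"
proof (cases "l' = l")
  case True
  then have "rademacher_coeff l' i (block_sign l j) = rademacher_coeff l i (rademacher j)"
    by (simp add: rademacher_coeff_def block_sign_nth)
  then show ?thesis
    using True assms by (simp add: rademacher_coeff_rademacher)
next
  case False
  then have "apply_bcontfun (block_sign l j) v = 0" if "v \<in> block l'" for v
    using that block_disjoint by (auto simp: block_sign_nth)
  then show ?thesis
    using False by (simp add: rademacher_coeff_def)
qed

lemma sum_abs_block_sign_le:
  assumes "finite F" "\<forall>i\<in>F. v i \<in> block i"
  shows "(\<Sum>i\<in>F. \<bar>apply_bcontfun (block_sign l j) (v i)\<bar>) \<le> (if l \<in> F then 1 else 0)"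
proof -
  have "(\<Sum>i\<in>F. \<bar>apply_bcontfun (block_sign l j) (v i)\<bar>) \<le> (\<Sum>i\<in>F. if i = l then 1 else 0)"
    using assms(2) block_disjoint by (intro sum_mono) (auto simp: block_sign_nth)
  then show ?thesis
    using assms(1) by simp
qed

lemma square_norm_block_sign:
  assumes "j < l"
  shows "square_norm (block_sign l j) = 1"
proof (rule antisym)
  have "(\<Sum>i\<in>F. \<bar>apply_bcontfun (block_sign l j) (v i)\<bar>) \<le> real (card F) * 1"
    if "admissible F" "\<forall>i\<in>F. v i \<in> block i" for F v
  proof -
    have "finite F" "card F \<ge> 1"
      using that(1) by (auto simp: admissible_def Suc_le_eq card_gt_0_iff)
    then show ?thesis
      using sum_abs_block_sign_le[of F v l j] that(2) by (auto split: if_splits)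
  qed
  then show "square_norm (block_sign l j) \<le> 1"
    unfolding square_norm_le_iff using assms
    by (auto simp: rademacher_coeff_block_sign block_sign_nth)
  show "1 \<le> square_norm (block_sign l j)"
    using square_norm_le_iff[of "block_sign l j" "square_norm (block_sign l j)"] assms
      rademacher_coeff_block_sign[OF assms assms] by fastforce
qed

text \<open>The three families are affected in different ways. On the block the coordinates grow from at
  most 1 to at most 2, which half of a coordinate tolerates. An average grows only if \<open>l \<in> F\<close>, and
  then by at most \<open>1 / card F \<le> \<epsilon>\<close>. Only one Rademacher coefficient changes, and it was at most \<open>\<epsilon>\<close>
  before 1 was added.\<close>

lemma square_norm_add_block_sign_le:
  assumes x: "square_norm x \<le> 1" "l \<notin> bad_blocks x" "\<bar>rademacher_coeff l j x\<bar> \<le> \<epsilon>"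
    and "j < l" "\<epsilon> > 0" "1 / \<epsilon>\<^sup>2 \<le> l" "\<bar>s\<bar> = 1"
  shows "square_norm (x + s *\<^sub>R block_sign l j) \<le> 1 + \<epsilon>"
proof -
  let ?h = "block_sign l j"
  have x_le: "\<bar>apply_bcontfun x n\<bar> \<le> 2"
      "admissible F \<Longrightarrow> (\<forall>l\<in>F. v l \<in> block l) \<Longrightarrow>
        (\<Sum>l\<in>F. \<bar>apply_bcontfun x (v l)\<bar>) \<le> real (card F)"
      "i < l' \<Longrightarrow> \<bar>rademacher_coeff l' i x\<bar> \<le> 1" for n F v l' i
    using x(1) square_norm_le_iff[of x 1] by auto
  have abs_nth: "\<bar>apply_bcontfun (x + s *\<^sub>R ?h) n\<bar> \<le> \<bar>apply_bcontfun x n\<bar> + \<bar>apply_bcontfun ?h n\<bar>" for n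
    using abs_triangle_ineq[of "apply_bcontfun x n" "s * apply_bcontfun ?h n"] \<open>\<bar>s\<bar> = 1\<close>
    by (simp add: abs_mult)
  have "\<bar>apply_bcontfun (x + s *\<^sub>R ?h) n\<bar> \<le> 2 * (1 + \<epsilon>)" for n
  proof (cases "n \<in> block l")
    case True
    then show ?thesis
      using abs_nth[of n] x(2) \<open>\<epsilon> > 0\<close>
      by (fastforce simp: bad_blocks_def block_sign_nth)
  next
    case False
    then show ?thesis
      using x_le(1)[of n] \<open>\<epsilon> > 0\<close> by (simp add: block_sign_nth)
  qed
  moreover have "(\<Sum>i\<in>F. \<bar>apply_bcontfun (x + s *\<^sub>R ?h) (v i)\<bar>) \<le> real (card F) * (1 + \<epsilon>)"
    if F: "admissible F" "\<forall>i\<in>F. v i \<in> block i" for F v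
  proof -
    have "(\<Sum>i\<in>F. \<bar>apply_bcontfun (x + s *\<^sub>R ?h) (v i)\<bar>) \<le>
        (\<Sum>i\<in>F. \<bar>apply_bcontfun x (v i)\<bar>) + (\<Sum>i\<in>F. \<bar>apply_bcontfun ?h (v i)\<bar>)"
      unfolding sum.distrib[symmetric] by (intro sum_mono abs_nth)
    also have "\<dots> \<le> real (card F) + (if l \<in> F then 1 else 0)"
      using x_le(2)[OF F] sum_abs_block_sign_le[of F v l j] F by (simp add: admissible_def)
    also have "(if l \<in> F then 1 else 0) \<le> real (card F) * \<epsilon>"
    proof (cases "l \<in> F")
      case True
      \<comment> \<open>Admissibility puts \<open>l\<close> below \<open>(card F)\<^sup>2\<close>, so a late block occurs only in large sets.\<close>
      then have "real l \<le> (real (card F))\<^sup>2"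
        using F(1) unfolding admissible_def
        by (metis lessThan_iff less_imp_le of_nat_mono of_nat_power subsetD)
      then have "1 / \<epsilon>\<^sup>2 \<le> (real (card F))\<^sup>2"
        using assms(6) by linarith
      then have "1\<^sup>2 \<le> (real (card F) * \<epsilon>)\<^sup>2"
        using \<open>\<epsilon> > 0\<close> by (simp add: field_simps power_mult_distrib)
      then have "1 \<le> real (card F) * \<epsilon>"
        by (rule power2_le_imp_le) (use \<open>\<epsilon> > 0\<close> in simp)
      then show ?thesis by simp
    qed (use \<open>\<epsilon> > 0\<close> in simp)
    finally show ?thesis
      by (simp add: algebra_simps)
  qed
  moreover have "\<bar>rademacher_coeff l' i (x + s *\<^sub>R ?h)\<bar> \<le> 1 + \<epsilon>" if "i < l'" for l' i
  proof -
    have "rademacher_coeff l' i (x + s *\<^sub>R ?h) = rademacher_coeff l' i x + s * rademacher_coeff l' i ?h"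
      by (simp add: rademacher_coeff_def algebra_simps sum.distrib sum_distrib_left add_divide_distrib)
    then show ?thesis
      using x_le(3)[OF that] x(3) \<open>\<bar>s\<bar> = 1\<close> \<open>\<epsilon> > 0\<close> rademacher_coeff_block_sign[OF that \<open>j < l\<close>]
      by (auto split: if_splits)
  qed
  ultimately show ?thesis
    unfolding square_norm_le_iff by blast
qed

lemma almost_square_square_norm: "almost_square square_norm"
  unfolding almost_square_def
proof (intro allI impI)
  fix \<epsilon> :: real and X :: "linfty set"
  assume "\<epsilon> > 0" and X: "finite X \<and> X \<subseteq> {x. square_norm x = 1}"
  \<comment> \<open>The first summand makes room for a small coefficient, the second gives small weights in averages.\<close>
  obtain m :: nat where m: "real (card X) / \<epsilon>\<^sup>2 + 1 / \<epsilon>\<^sup>2 < m"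
    using reals_Archimedean2 by blast
  obtain l where l: "l \<ge> m" "\<And>x. x \<in> X \<Longrightarrow> l \<notin> bad_blocks x"
    using exists_good_block[of X m] X by (auto simp: subset_iff)
  have "real (card X) / \<epsilon>\<^sup>2 \<ge> 0" "1 / \<epsilon>\<^sup>2 > 0" "real m \<le> real l"
    using \<open>\<epsilon> > 0\<close> l(1) by auto
  then have large: "real (card X) / \<epsilon>\<^sup>2 < l" "1 / \<epsilon>\<^sup>2 \<le> l"
    using m by linarith+
  from large(1) have "real (card X) < real l * \<epsilon>\<^sup>2"
    using \<open>\<epsilon> > 0\<close> by (simp add: field_simps)
  then obtain j where j: "j < l" "\<And>x. x \<in> X \<Longrightarrow> \<bar>rademacher_coeff l j x\<bar> \<le> \<epsilon>"
    using exists_small_rademacher_coeff[of X l \<epsilon>] X l(2) \<open>\<epsilon> > 0\<close> by auto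
  have "square_norm (x + s *\<^sub>R block_sign l j) \<le> 1 + \<epsilon>" if "x \<in> X" "\<bar>s\<bar> = 1" for x s
    using that X l(2) j \<open>\<epsilon> > 0\<close> large(2) by (intro square_norm_add_block_sign_le) auto
  from this[of _ 1] this[of _ "- 1"] square_norm_block_sign[OF j(1)]
  show "\<exists>h. square_norm h = 1 \<and>
      (\<forall>x\<in>X. square_norm (x + h) \<le> 1 + \<epsilon> \<and> square_norm (x - h) \<le> 1 + \<epsilon>)"
    by (intro exI[of _ "block_sign l j"]) simp
qed

theorem theorem3p4:
  shows "\<exists>M :: linfty \<Rightarrow> real. bidual_renorming_linfty M \<and> almost_square M"
proof (intro exI conjI)
  have "strict_mono (\<lambda>L. 2 ^ L :: nat)"
    by (auto simp: strict_mono_def)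
  then have "square_norm x = bidual_norm (\<lambda>y. square_norm (linfty_of_c0 y)) (c0_bidual_of_linfty x)"
    for x
    by (rule square.bidual_norm_sup_over[OF _ square_norm_truncation_le, symmetric])
  then show "bidual_renorming_linfty square_norm"
    unfolding bidual_renorming_linfty_def
    using square.equivalent_norm_sup_over square.equivalent_norm_c0 by blast
  show "almost_square square_norm"
    by (rule almost_square_square_norm)
qed

end
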